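(* Fix $d\in\mathbb{N}$ and $p\in(0,1)$. There is a constant $C=C(d,p)$ such that the following holds. Let $n\in\mathbb{N}$, let $f$ be a degree-$d$ multilinear polynomial in $n$ variables with real nonnegative coefficients, and let $\boldsymbol{\xi}=(\xi_1,\dots,\xi_n)$ have independent $\mathrm{Ber}(p)$ entries. Suppose $r(f)\ge 1$. Then for every $x\in\mathbb{R}$, \[ \Pr\left(|f(\boldsymbol{\xi})-x|<1\right)\le \frac{C}{\sqrt{r(f)}}. \]
   Context: $\mathrm{Ber}(p)$ denotes the distribution of a random variable equal to $1$ with probability $p$ and $0$ with probability $1-p$. For a multilinear polynomial $f$ in $n$ variables, $r(f)$ is the size of a largest matching (collection of pairwise disjoint hyperedges) in the (non-uniform) hypergraph on vertex set $\{1,\dots,n\}$ that has a hyperedge $\{i_1,\dots,i_k\}$ whenever the coefficient of $x_{i_1}\cdots x_{i_k}$ in $f$ has absolute value at least $1$. *)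

theory Defs
  imports "HOL-Probability.Probability" "HOL-Library.Disjoint_Sets"
begin

text \<open>A multilinear polynomial in the variables $x_1,\dots,x_n$ is represented by the number \<open>n\<close>
  and its coefficients \<open>a S\<close>, where \<open>S\<close> ranges over the subsets of \<open>{1..n}\<close> and stands for the
  monomial $\prod_{i\in S} x_i$. Values of \<open>a\<close> on other sets are irrelevant.\<close>

definition ml_eval :: "nat \<Rightarrow> (nat set \<Rightarrow> real) \<Rightarrow> (nat \<Rightarrow> real) \<Rightarrow> real" where
  "ml_eval n a x = (\<Sum>S\<in>Pow {1..n}. a S * (\<Prod>i\<in>S. x i))"

text \<open>The zero polynomial has degree 0 by convention.\<close>

definition ml_degree :: "nat \<Rightarrow> (nat set \<Rightarrow> real) \<Rightarrow> nat" where
  "ml_degree n a = Max (insert 0 (card ` {S. S \<subseteq> {1..n} \<and> a S \<noteq> 0}))"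

text \<open>Hyperedges are nonempty, so the constant term contributes none.\<close>

definition ml_hyperedges :: "nat \<Rightarrow> (nat set \<Rightarrow> real) \<Rightarrow> nat set set" where
  "ml_hyperedges n a = {S. S \<subseteq> {1..n} \<and> S \<noteq> {} \<and> \<bar>a S\<bar> \<ge> 1}"

definition ml_matching_number :: "nat \<Rightarrow> (nat set \<Rightarrow> real) \<Rightarrow> nat" where
  "ml_matching_number n a = Max {card M | M. M \<subseteq> ml_hyperedges n a \<and> disjoint M}"

definition ber :: "real \<Rightarrow> real pmf" where
  "ber p = map_pmf of_bool (bernoulli_pmf p)"

text \<open>The law of $(\xi_1,\dots,\xi_n)$ with independent $\mathrm{Ber}(p)$ entries; coordinates
  outside \<open>{1..n}\<close> are constantly 0.\<close>

definition ber_vector :: "nat \<Rightarrow> real \<Rightarrow> (nat \<Rightarrow> real) pmf" where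
  "ber_vector n p = Pi_pmf {1..n} 0 (\<lambda>_. ber p)"

end

theory Submission
  imports Defs
begin

text \<open>Of a largest matching keep the edges of the most frequent size \<open>k\<close>, at least a fraction
  \<open>1 / d\<close> of them. For each kept edge first reveal its state conditioned on not being all ones,
  and then, with probability \<open>q = p ^ k\<close>, overwrite it by all ones. Conditionally on the first
  stage, \<open>f\<close> is a function of the set \<open>I\<close> of overwritten edges. Since the coefficients are
  nonnegative, enlarging \<open>I\<close> increases \<open>f\<close> by at least 1, so the sets \<open>I\<close> with \<open>f\<close> in a
  half-open interval of length 1 form an antichain. By the LYM inequality its probability is at most
  the largest point probability of a binomial distribution, which is of order
  \<open>1 / sqrt m\<close> for \<open>m\<close> kept edges. Two such intervals cover \<open>{x - 1<..<x + 1}\<close>.\<close>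

section \<open>Averages over random subsets\<close>

text \<open>For finite \<open>V\<close> and \<open>q\<close> in [0,1] this is the expectation of
  \<open>\<phi>\<close> at a random subset containing each point of \<open>V\<close> independently
  with probability \<open>q\<close>. As a finite sum it needs no measurability or integrability
  arguments.\<close>

definition subset_avg :: "real \<Rightarrow> 'a set \<Rightarrow> ('a set \<Rightarrow> real) \<Rightarrow> real" where
  "subset_avg q V \<phi> = (\<Sum>S\<in>Pow V. q ^ card S * (1 - q) ^ card (V - S) * \<phi> S)"

lemma subset_avg_add: "subset_avg q V (\<lambda>S. \<phi> S + \<psi> S) = subset_avg q V \<phi> + subset_avg q V \<psi>"
  by (simp add: subset_avg_def algebra_simps sum.distrib)

lemma subset_avg_cmult: "subset_avg q V (\<lambda>S. c * \<phi> S) = c * subset_avg q V \<phi>"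
  by (simp add: subset_avg_def sum_distrib_left algebra_simps)

lemma subset_avg_sum: "subset_avg q V (\<lambda>S. \<Sum>i\<in>I. \<phi> i S) = (\<Sum>i\<in>I. subset_avg q V (\<phi> i))"
  unfolding subset_avg_def sum_distrib_left by (rule sum.swap)

lemma subset_avg_one:
  assumes "finite V"
  shows "subset_avg q V (\<lambda>_. 1) = 1"
proof -
  have "(\<Prod>i\<in>V. q + (1 - q)) = (\<Sum>X\<in>Pow V. (\<Prod>x\<in>X. q) * (\<Prod>x\<in>V - X. 1 - q))"
    by (rule prod_add) fact
  then show ?thesis
    by (simp add: subset_avg_def)
qed

text \<open>The traces of the random set on \<open>V\<close> and \<open>W\<close> are independent,
  because both the weights and the cardinalities split over a disjoint union.\<close>

lemma subset_avg_union:
  assumes "finite V" "finite W" "V \<inter> W = {}"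
  shows "subset_avg q (V \<union> W) \<phi> = subset_avg q V (\<lambda>S. subset_avg q W (\<lambda>T. \<phi> (S \<union> T)))"
proof -
  have "subset_avg q V (\<lambda>S. subset_avg q W (\<lambda>T. \<phi> (S \<union> T))) =
      (\<Sum>(S, T)\<in>Pow V \<times> Pow W. q ^ card S * (1 - q) ^ card (V - S) *
         (q ^ card T * (1 - q) ^ card (W - T) * \<phi> (S \<union> T)))"
    unfolding subset_avg_def sum_distrib_left by (rule sum.cartesian_product)
  also have "\<dots> = subset_avg q (V \<union> W) \<phi>"
    unfolding subset_avg_def
  proof (rule sum.reindex_bij_witness[where i = "\<lambda>S. (S \<inter> V, S \<inter> W)" and j = "\<lambda>(S, T). S \<union> T"], goal_cases)
    case (5 ST)
    obtain S T where ST: "ST = (S, T)" "S \<subseteq> V" "T \<subseteq> W"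
      using 5 by auto
    have fin: "finite S" "finite T"
      using ST assms finite_subset by blast+
    have "card (S \<union> T) = card S + card T"
      using ST assms fin by (intro card_Un_disjoint) auto
    moreover have "card (V \<union> W - (S \<union> T)) = card (V - S) + card (W - T)"
    proof -
      have "V \<union> W - (S \<union> T) = (V - S) \<union> (W - T)"
        using ST assms by blast
      then show ?thesis
        using assms by (auto intro: card_Un_disjoint)
    qed
    ultimately show ?case
      by (simp add: ST power_add)
  qed (use assms in auto)
  finally show ?thesis by simp
qed

lemma subset_avg_cong:
  "(\<And>S. S \<subseteq> V \<Longrightarrow> \<phi> S = \<psi> S) \<Longrightarrow> subset_avg q V \<phi> = subset_avg q V \<psi>"
  by (simp add: subset_avg_def)

lemma subset_avg_empty: "subset_avg q {} \<phi> = \<phi> {}"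
  by (simp add: subset_avg_def)

lemma subset_avg_insert:
  assumes "finite V" "x \<notin> V"
  shows "subset_avg q (insert x V) \<phi> = subset_avg q V (\<lambda>S. (1 - q) * \<phi> S + q * \<phi> (insert x S))"
proof -
  have "subset_avg q {x} (\<lambda>T. \<phi> (S \<union> T)) = (1 - q) * \<phi> S + q * \<phi> (insert x S)" for S
    by (simp add: subset_avg_def Pow_insert Pow_empty)
  then show ?thesis
    using subset_avg_union[of V "{x}" q \<phi>] assms by simp
qed

lemma subset_avg_mono:
  assumes "0 \<le> q" "q \<le> 1" "\<And>S. S \<subseteq> V \<Longrightarrow> \<phi> S \<le> \<psi> S"
  shows "subset_avg q V \<phi> \<le> subset_avg q V \<psi>"
  unfolding subset_avg_def using assms by (intro sum_mono mult_left_mono) auto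

section \<open>Two-stage sampling of the matching edges\<close>

text \<open>Here \<open>z e\<close> is the first-stage state of the edge \<open>e\<close>, and \<open>S\<close> that of the vertices outside
  the matching.\<close>

lemma subset_avg_two_stage_le:
  fixes \<phi> :: "'a set \<Rightarrow> real"
  assumes p: "0 < p" "p < 1" and "finite M" "finite V" "k \<noteq> 0"
    and "disjoint M" "\<And>e. e \<in> M \<Longrightarrow> finite e \<and> card e = k \<and> e \<inter> V = {}"
    and "\<And>S z. S \<subseteq> V \<Longrightarrow> (\<And>e. e \<in> M \<Longrightarrow> z e \<subset> e) \<Longrightarrow>
      subset_avg (p ^ k) M (\<lambda>I. \<phi> (S \<union> (\<Union>e\<in>M. if e \<in> I then e else z e))) \<le> B"
  shows "subset_avg p (V \<union> \<Union>M) \<phi> \<le> B"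
  using assms(3-)
proof (induction M arbitrary: \<phi> rule: finite_induct)
  case empty
  have "\<phi> S \<le> B" if "S \<subseteq> V" for S
    using empty.prems(5)[of S] that by (simp add: subset_avg_empty)
  then have "subset_avg p V \<phi> \<le> subset_avg p V (\<lambda>_. B * 1)"
    using p by (intro subset_avg_mono) auto
  then show ?case
    using subset_avg_cmult[of p V B "\<lambda>_. 1"] subset_avg_one[of V p] empty.prems(1) by simp
next
  case (insert e M)
  let ?W = "V \<union> \<Union>M" and ?q = "p ^ k"
  let ?w = "\<lambda>T. p ^ card T * (1 - p) ^ card (e - T)"
  let ?P = "Pow e - {e}"
  have q: "0 < ?q" "?q < 1"
    using p insert.prems by (auto simp: power_Suc_less_one power_less_one_iff)
  have e: "finite e" "card e = k" "e \<inter> V = {}"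
    using insert.prems by auto
  have dis: "e \<inter> e' = {}" if "e' \<in> M" for e'
    using insert.prems(3) insert.hyps that by (auto simp: disjoint_def)
  have we: "?w e = ?q"
    using e by simp
  have "(\<Sum>T\<in>Pow e. ?w T) = 1"
    using subset_avg_one[OF e(1), of p] by (simp add: subset_avg_def)
  then have wsum: "(\<Sum>T\<in>?P. ?w T) = 1 - ?q"
    using we e by (simp add: sum_diff1)
  \<comment> \<open>\<open>\<omega> T\<close> performs the second stage on \<open>e\<close> alone,
    \<open>T\<close> being its first-stage state. The induction hypothesis is applied to
    \<open>\<omega> T\<close> in place of \<open>\<phi>\<close>, which is why \<open>\<phi>\<close>
    is generalized.\<close>
  define \<omega> where "\<omega> T S = (1 - ?q) * \<phi> (S \<union> T) + ?q * \<phi> (S \<union> e)" for T S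
  have avg: "subset_avg p ?W (\<omega> T) \<le> B" if T: "T \<in> ?P" for T
  proof (rule insert.IH)
    show "disjoint M"
      using insert.prems(3) by (auto simp: disjoint_def)
    fix S z
    assume S: "S \<subseteq> V" and z: "\<And>e. e \<in> M \<Longrightarrow> z e \<subset> e"
    let ?z = "z(e := T)"
    let ?U = "\<lambda>I. \<Union>e\<in>M. if e \<in> I then e else z e"
    have U: "(\<Union>f\<in>M. if f \<in> I then f else ?z f) = ?U I"
        "(\<Union>f\<in>M. if f = e \<or> f \<in> I then f else ?z f) = ?U I" for I
      using insert.hyps by (auto split: if_splits)
    have "subset_avg ?q (insert e M) (\<lambda>I. \<phi> (S \<union> (\<Union>f\<in>insert e M. if f \<in> I then f else ?z f))) \<le> B"
    proof (rule insert.prems(5)[OF S])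
      show "?z f \<subset> f" if "f \<in> insert e M" for f
        using z[of f] T that by (cases "f = e") auto
    qed
    also have "subset_avg ?q (insert e M) (\<lambda>I. \<phi> (S \<union> (\<Union>f\<in>insert e M. if f \<in> I then f else ?z f))) =
        subset_avg ?q M (\<lambda>I. \<omega> T (S \<union> ?U I))"
      unfolding subset_avg_insert[OF insert.hyps]
    proof (rule subset_avg_cong)
      fix I assume "I \<subseteq> M"
      then have "e \<notin> I"
        using insert.hyps by auto
      then have "(\<Union>f\<in>insert e M. if f \<in> I then f else ?z f) = T \<union> ?U I"
          "(\<Union>f\<in>insert e M. if f \<in> insert e I then f else ?z f) = e \<union> ?U I"
        by (simp_all only: UN_insert insert_iff simp_thms if_True if_False fun_upd_same U)
      then show "(1 - ?q) * \<phi> (S \<union> (\<Union>f\<in>insert e M. if f \<in> I then f else ?z f)) +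
          ?q * \<phi> (S \<union> (\<Union>f\<in>insert e M. if f \<in> insert e I then f else ?z f)) = \<omega> T (S \<union> ?U I)"
        by (simp only: \<omega>_def Un_ac)
    qed
    finally show "subset_avg ?q M (\<lambda>I. \<omega> T (S \<union> ?U I)) \<le> B" .
  qed (use insert.prems in auto)
  have "V \<union> \<Union>(insert e M) = ?W \<union> e"
    by auto
  also have "subset_avg p \<dots> \<phi> = subset_avg p ?W (\<lambda>S. subset_avg p e (\<lambda>T. \<phi> (S \<union> T)))"
  proof (rule subset_avg_union)
    show "finite ?W"
      using insert.hyps insert.prems(1,4) by auto
    show "?W \<inter> e = {}"
      using e(3) dis by blast
  qed fact
  \<comment> \<open>The weights \<open>?w T / (1 - ?q)\<close> are the law of the trace on
    \<open>e\<close> conditioned on not being all of \<open>e\<close>. Keeping \<open>T\<close> with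
    probability \<open>1 - ?q\<close> restores its mass \<open>?w T\<close>, and overwriting gives
    \<open>e\<close> its mass \<open>?q = ?w e\<close>.\<close>
  also have "(\<lambda>S. subset_avg p e (\<lambda>T. \<phi> (S \<union> T))) = (\<lambda>S. \<Sum>T\<in>?P. ?w T / (1 - ?q) * \<omega> T S)"
  proof
    fix S
    have split: "w / c * (c * x + y * z) = w * x + w * (y / c * z)" if "c \<noteq> 0" for w c x y z :: real
      using that by (simp add: field_simps)
    have "(\<Sum>T\<in>?P. ?w T / (1 - ?q) * \<omega> T S) =
        (\<Sum>T\<in>?P. ?w T * \<phi> (S \<union> T)) + (\<Sum>T\<in>?P. ?w T) * (?q / (1 - ?q) * \<phi> (S \<union> e))"
      unfolding sum_distrib_right sum.distrib[symmetric]
      unfolding \<omega>_def using q by (intro sum.cong refl split) simp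
    also have "\<dots> = (\<Sum>T\<in>?P. ?w T * \<phi> (S \<union> T)) + ?w e * \<phi> (S \<union> e)"
      unfolding wsum we using q by simp
    also have "\<dots> = subset_avg p e (\<lambda>T. \<phi> (S \<union> T))"
      unfolding subset_avg_def using e by (simp add: sum_diff1)
    finally show "subset_avg p e (\<lambda>T. \<phi> (S \<union> T)) = (\<Sum>T\<in>?P. ?w T / (1 - ?q) * \<omega> T S)" ..
  qed
  also have "subset_avg p ?W \<dots> = (\<Sum>T\<in>?P. ?w T / (1 - ?q) * subset_avg p ?W (\<omega> T))"
    by (simp only: subset_avg_sum subset_avg_cmult)
  also have "\<dots> \<le> (\<Sum>T\<in>?P. ?w T / (1 - ?q) * B)"
    using p q avg by (intro sum_mono mult_left_mono) auto
  also have "\<dots> = (\<Sum>T\<in>?P. ?w T) / (1 - ?q) * B"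
    by (simp only: sum_distrib_right sum_divide_distrib)
  also have "\<dots> = B"
    unfolding wsum using q by simp
  finally show ?case .
qed

section \<open>Antichains and the LYM inequality\<close>

definition antichain :: "'a set set \<Rightarrow> bool" where
  "antichain A \<longleftrightarrow> (\<forall>S\<in>A. \<forall>T\<in>A. \<not> S \<subset> T)"

text \<open>The absorption identity, arranged for averaging: an \<open>s\<close>-subset of an
  \<open>m\<close>-set misses \<open>m - s\<close> points, and each of these contributes a
  \<open>1 / m\<close> share of the set's weight in a ground set of size
  \<open>m - 1\<close>.\<close>

lemma inverse_choose_eq:
  assumes "s < m"
  shows "1 / real (m choose s) = real (m - s) / (real m * real ((m - 1) choose s))"
proof -
  have "(m - s) * (m choose s) = m * ((m - 1) choose s)"
    using binomial_absorb_comp[of m s] .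
  then have "real (m - s) * real (m choose s) = real m * real ((m - 1) choose s)"
    by (metis of_nat_mult)
  moreover have "real (m choose s) > 0" "real ((m - 1) choose s) > 0" "m > 0"
    using assms by (auto simp: zero_less_binomial_iff)
  ultimately show ?thesis
    by (simp add: divide_simps mult.commute)
qed

text \<open>The Lubell--Yamamoto--Meshalkin inequality. The induction averages over the point \<open>v\<close> removed
  from the ground set.\<close>

lemma LYM:
  assumes "finite V" "antichain A" "A \<subseteq> Pow V"
  shows "(\<Sum>S\<in>A. 1 / real (card V choose card S)) \<le> 1"
  using assms
proof (induction "card V" arbitrary: V A)
  case 0
  then have "A \<subseteq> {{}}"
    by auto
  then have "A = {} \<or> A = {{}}"
    by auto
  then show ?case by auto
next
  case (Suc m)
  show ?case
  proof (cases "V \<in> A")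
    case True
    then have "A = {V}"
      using Suc.prems by (auto simp: antichain_def)
    then show ?thesis by simp
  next
    case False
    have finA: "finite A"
      using Suc.prems finite_subset by blast
    let ?c = "card V"
    have cV: "real ?c > 0"
      using Suc.hyps by simp
    \<comment> \<open>The LYM weight of \<open>S\<close> is spread evenly over the points outside
      \<open>S\<close>. Such points exist because the case \<open>V \<in> A\<close> has been split
      off.\<close>
    have "1 / real (?c choose card S) = (\<Sum>v\<in>V. if v \<notin> S then 1 / real (m choose card S) / real ?c else 0)"
      if S: "S \<in> A" for S
    proof -
      have "S \<subset> V"
        using S False Suc.prems by auto
      then have lt: "card S < ?c" "card (V - S) = ?c - card S"
        using Suc.prems by (auto simp: psubset_card_mono card_Diff_subset finite_subset)
      have "(\<Sum>v\<in>V. if v \<notin> S then 1 / real (m choose card S) / real ?c else 0)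
          = (\<Sum>v\<in>V - S. 1 / real (m choose card S) / real ?c)"
        using Suc.prems by (intro sum.mono_neutral_cong_right) auto
      also have "\<dots> = real (?c - card S) / (real ?c * real (m choose card S))"
        using lt by simp
      also have "\<dots> = 1 / real (?c choose card S)"
        using inverse_choose_eq[OF lt(1)] Suc.hyps(2)[symmetric] by simp
      finally show ?thesis ..
    qed
    then have "(\<Sum>S\<in>A. 1 / real (?c choose card S)) =
        (\<Sum>S\<in>A. \<Sum>v\<in>V. if v \<notin> S then 1 / real (m choose card S) / real ?c else 0)"
      by (rule sum.cong[OF refl])
    also have "\<dots> = (\<Sum>v\<in>V. \<Sum>S\<in>A. if v \<notin> S then 1 / real (m choose card S) / real ?c else 0)"
      by (rule sum.swap)
    also have "\<dots> = (\<Sum>v\<in>V. (\<Sum>S\<in>{S\<in>A. v \<notin> S}. 1 / real (m choose card S)) / real ?c)"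
      unfolding sum_divide_distrib by (simp only: sum.inter_filter[OF finA])
    also have "\<dots> \<le> (\<Sum>v\<in>V. 1 / real ?c)"
    proof (intro sum_mono divide_right_mono)
      fix v assume v: "v \<in> V"
      have m: "m = card (V - {v})"
        using v Suc.prems Suc.hyps(2) by (simp add: card_Diff_singleton)
      show "(\<Sum>S\<in>{S\<in>A. v \<notin> S}. 1 / real (m choose card S)) \<le> 1"
        using Suc.hyps(1)[OF m, of "{S\<in>A. v \<notin> S}"] Suc.prems m
        by (auto simp: antichain_def)
    qed simp
    also have "\<dots> = 1"
      using cV by simp
    finally show ?thesis .
  qed
qed

section \<open>Point probabilities of binomial distributions\<close>

text \<open>Consecutive terms have ratio \<open>(2 * n + 1) / (2 * n + 2)\<close>, so the induction
  step comes down to \<open>(2 * n + 1) * (2 * n + 3) \<le> (2 * n + 2)\<^sup>2\<close>.\<close>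

lemma central_binomial_le: "real ((2 * n) choose n) / 4 ^ n \<le> 1 / sqrt (2 * real n + 1)"
proof (induction n)
  case (Suc n)
  have "Suc n * ((2 * Suc n) choose Suc n) = 2 * (Suc n * ((2 * n + 1) choose n))"
    using Suc_times_binomial_eq[of "2 * n + 1" n] by (simp add: mult.commute del: binomial_Suc_Suc)
  also have "\<dots> = 2 * (2 * n + 1) * ((2 * n) choose n)"
    using binomial_absorb_comp[of "2 * n + 1" n] by (simp del: binomial_Suc_Suc)
  finally have "Suc n * ((2 * Suc n) choose Suc n) = 2 * (2 * n + 1) * ((2 * n) choose n)" .
  then have "real (Suc n) * real ((2 * Suc n) choose Suc n) = 2 * (2 * real n + 1) * real ((2 * n) choose n)"
    by (metis (no_types, opaque_lifting) of_nat_mult of_nat_add of_nat_1 of_nat_numeral)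
  then have "real ((2 * Suc n) choose Suc n) / 4 ^ Suc n =
      (2 * real n + 1) / (2 * real n + 2) * (real ((2 * n) choose n) / 4 ^ n)"
    by (simp add: divide_simps) (simp add: algebra_simps)
  also have "\<dots> \<le> (2 * real n + 1) / (2 * real n + 2) * (1 / sqrt (2 * real n + 1))"
    by (intro mult_left_mono Suc.IH) auto
  also have "\<dots> = sqrt (2 * real n + 1) / (2 * real n + 2)"
    by (simp add: real_div_sqrt divide_simps)
  also have "\<dots> \<le> 1 / sqrt (2 * real (Suc n) + 1)"
  proof -
    have "sqrt (2 * real n + 1) * sqrt (2 * real (Suc n) + 1) \<le> sqrt ((2 * real n + 2)\<^sup>2)"
      unfolding real_sqrt_mult[symmetric] by (rule real_sqrt_le_mono) (simp add: power2_eq_square algebra_simps)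
    also have "\<dots> = 2 * real n + 2"
      by simp
    finally show ?thesis
      by (simp add: divide_simps mult.commute)
  qed
  finally show ?case .
qed simp

lemma choose_div_two_power_le: "real (j choose k) / 2 ^ j \<le> 1 / sqrt (real j + 1)"
proof -
  have "real (j choose k) / 2 ^ j \<le> real (j choose (j div 2)) / 2 ^ j"
    by (simp add: divide_right_mono binomial_maximum)
  also have "\<dots> \<le> 1 / sqrt (real j + 1)"
  proof (cases "even j")
    case True
    then obtain n where "j = 2 * n" by auto
    then show ?thesis
      using central_binomial_le[of n] by (simp add: power_mult)
  next
    case False
    then obtain n where j: "j = 2 * n + 1"
      using oddE by blast
    \<comment> \<open>An odd row has two equal middle entries, which add up to the central entry of
      the next row; after normalization the odd case becomes the even one.\<close>
    have "Suc (2 * n) choose Suc n = Suc (2 * n) choose n"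
      using binomial_symmetric[of n "Suc (2 * n)"] by simp
    then have "(2 * Suc n) choose Suc n = 2 * (j choose n)"
      by (simp add: j)
    then have "real (j choose (j div 2)) / 2 ^ j = real ((2 * Suc n) choose Suc n) / 4 ^ Suc n"
      by (simp add: j power_mult)
    also have "\<dots> \<le> 1 / sqrt (2 * real (Suc n) + 1)"
      by (rule central_binomial_le)
    also have "\<dots> \<le> 1 / sqrt (real j + 1)"
      by (intro divide_left_mono mult_pos_pos real_sqrt_le_mono) (auto simp: j)
    finally show ?thesis .
  qed
  finally show ?thesis .
qed

text \<open>For a binomial variable \<open>X\<close> this bounds the expectation of
  \<open>1 / (X + 1)\<close>. Absorption turns the sum into the binomial expansion of row
  \<open>Suc m\<close> without its term of index 0, hence into at most 1.\<close>

lemma binomial_expectation_inverse_Suc: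
  assumes "0 < t" "t \<le> 1"
  shows "(\<Sum>j\<le>m. real (m choose j) * t ^ j * (1 - t) ^ (m - j) / real (Suc j)) \<le> 1 / (real (Suc m) * t)"
proof -
  have *: "real (m choose j) / real (Suc j) = real (Suc m choose Suc j) / real (Suc m)" for j
  proof -
    have "real (Suc j) * real (Suc m choose Suc j) = real (Suc m) * real (m choose j)"
      using Suc_times_binomial_eq[of m j] by (metis of_nat_mult mult.commute)
    then show ?thesis
      by (simp add: divide_simps mult.commute del: binomial_Suc_Suc)
  qed
  have "(\<Sum>j\<le>m. real (m choose j) * t ^ j * (1 - t) ^ (m - j) / real (Suc j)) =
      (\<Sum>j\<le>m. real (Suc m choose Suc j) * t ^ Suc j * (1 - t) ^ (Suc m - Suc j)) / (real (Suc m) * t)"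
    unfolding sum_divide_distrib
  proof (rule sum.cong)
    fix j
    have "real (m choose j) * t ^ j * (1 - t) ^ (m - j) / real (Suc j)
        = (real (m choose j) / real (Suc j)) * t ^ j * (1 - t) ^ (m - j)" by simp
    then show "real (m choose j) * t ^ j * (1 - t) ^ (m - j) / real (Suc j) =
        real (Suc m choose Suc j) * t ^ Suc j * (1 - t) ^ (Suc m - Suc j) / (real (Suc m) * t)"
      unfolding * using assms by (simp del: binomial_Suc_Suc of_nat_Suc)
  qed simp
  also have "\<dots> \<le> (\<Sum>j\<le>Suc m. real (Suc m choose j) * t ^ j * (1 - t) ^ (Suc m - j)) / (real (Suc m) * t)"
    unfolding sum.atMost_Suc_shift[of _ m] using assms by (intro divide_right_mono) auto
  also have "(\<Sum>j\<le>Suc m. real (Suc m choose j) * t ^ j * (1 - t) ^ (Suc m - j)) = (t + (1 - t)) ^ Suc m"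
    by (rule binomial_ring[symmetric])
  finally show ?thesis by simp
qed


text \<open>A binomial variable with parameter \<open>q \<le> 1 / 2\<close> is a fair binomial variable whose number of
  trials is itself binomial with parameter \<open>2 * q\<close>.\<close>

lemma binomial_mixture:
  fixes q :: real
  assumes "k \<le> m"
  shows "real (m choose k) * q ^ k * (1 - q) ^ (m - k) =
    (\<Sum>j\<le>m. real (m choose j) * (2 * q) ^ j * (1 - 2 * q) ^ (m - j) * (real (j choose k) / 2 ^ j))"
proof -
  have "(\<Sum>j\<le>m. real (m choose j) * (2 * q) ^ j * (1 - 2 * q) ^ (m - j) * (real (j choose k) / 2 ^ j)) =
      (\<Sum>j\<in>{k..m}. real (m choose j) * (2 * q) ^ j * (1 - 2 * q) ^ (m - j) * (real (j choose k) / 2 ^ j))"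
    by (intro sum.mono_neutral_right) auto
  \<comment> \<open>Trinomial revision with \<open>j = i + k\<close>. The powers of 2 cancel, and
    what remains is the expansion of \<open>(q + (1 - 2 * q)) ^ (m - k)\<close>.\<close>
  also have "\<dots> = (\<Sum>i\<le>m - k. real (m choose k) * q ^ k *
      (real ((m - k) choose i) * q ^ i * (1 - 2 * q) ^ (m - k - i)))"
  proof (rule sum.reindex_bij_witness[where i = "\<lambda>i. i + k" and j = "\<lambda>j. j - k"])
    fix j assume j: "j \<in> {k..m}"
    then have "(m choose j) * (j choose k) = (m choose k) * ((m - k) choose (j - k))"
      by (intro choose_mult) auto
    then have 1: "real (m choose j) * real (j choose k) = real (m choose k) * real ((m - k) choose (j - k))"
      by (metis of_nat_mult)
    have 2: "q ^ j = q ^ k * q ^ (j - k)" "m - k - (j - k) = m - j"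
      using j by (auto simp flip: power_add)
    have "real (m choose j) * (2 * q) ^ j * (1 - 2 * q) ^ (m - j) * (real (j choose k) / 2 ^ j) =
        (real (m choose j) * real (j choose k)) * q ^ j * (1 - 2 * q) ^ (m - j)"
      by (simp add: power_mult_distrib)
    also have "\<dots> = real (m choose k) * q ^ k * (real ((m - k) choose (j - k)) * q ^ (j - k) *
        (1 - 2 * q) ^ (m - k - (j - k)))"
      unfolding 1 2 by (simp only: mult_ac)
    finally show "real (m choose k) * q ^ k * (real ((m - k) choose (j - k)) * q ^ (j - k) *
        (1 - 2 * q) ^ (m - k - (j - k))) =
        real (m choose j) * (2 * q) ^ j * (1 - 2 * q) ^ (m - j) * (real (j choose k) / 2 ^ j)" ..
  qed (use assms in auto)
  also have "\<dots> = real (m choose k) * q ^ k * (q + (1 - 2 * q)) ^ (m - k)"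
    unfolding binomial_ring sum_distrib_left by simp
  finally show ?thesis by (simp add: algebra_simps)
qed

text \<open>By the mixture, the fair bound \<open>1 / sqrt (j + 1)\<close> is averaged over
  \<open>j\<close> binomial with parameter \<open>2 * q\<close>. Only the mean of
  \<open>1 / (j + 1)\<close> is controlled, so the square root is first linearized.\<close>

lemma binomial_prob_le_half:
  fixes q :: real
  assumes q: "0 < q" "q \<le> 1 / 2" and "k \<le> m"
  shows "real (m choose k) * q ^ k * (1 - q) ^ (m - k) \<le> 1 / sqrt (2 * q * real (Suc m))"
proof -
  define b where "b j = real (m choose j) * (2 * q) ^ j * (1 - 2 * q) ^ (m - j)" for j
  define s where "s = sqrt (2 * q * real (Suc m))"
  have s: "s > 0" "s * s = 2 * q * real (Suc m)"
    using q by (auto simp: s_def simp del: of_nat_Suc)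
  have b0: "b j \<ge> 0" for j
    using q by (simp add: b_def)
  have b1: "(\<Sum>j\<le>m. b j) = 1"
    unfolding b_def binomial_ring[symmetric] by simp
  have b2: "(\<Sum>j\<le>m. b j / real (Suc j)) \<le> 1 / (s * s)"
    using binomial_expectation_inverse_Suc[of "2 * q" m] q unfolding b_def s by (simp add: mult_ac)
  \<comment> \<open>AM-GM with \<open>r = sqrt (j + 1)\<close>: the bound for \<open>1 / r\<close>
    is linear in \<open>1 / (r * r)\<close> and sharp at \<open>r = s\<close>. Since
    \<open>1 / (s * s)\<close> bounds the mean of \<open>1 / (j + 1)\<close>, averaging returns
    exactly \<open>1 / s\<close>.\<close>
  have amgm: "real (j choose k) / 2 ^ j \<le> (s / real (Suc j) + 1 / s) / 2" for j
  proof -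
    define r where "r = sqrt (real j + 1)"
    have r: "r > 0" "real (Suc j) = r * r"
      by (auto simp: r_def)
    have "real (j choose k) / 2 ^ j \<le> 1 / r"
      unfolding r_def by (rule choose_div_two_power_le)
    also have "\<dots> \<le> (s / (r * r) + 1 / s) / 2"
    proof -
      have "2 * (r * s) \<le> r * r + s * s"
        using sum_squares_ge_zero[of "s - r" 0] by (simp add: algebra_simps)
      then show ?thesis
        using s(1) r(1) by (simp add: divide_simps mult_ac)
    qed
    finally show ?thesis
      unfolding r(2) .
  qed
  have "real (m choose k) * q ^ k * (1 - q) ^ (m - k) = (\<Sum>j\<le>m. b j * (real (j choose k) / 2 ^ j))"
    unfolding b_def by (rule binomial_mixture) fact
  also have "\<dots> \<le> (\<Sum>j\<le>m. b j * ((s / real (Suc j) + 1 / s) / 2))"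
    by (intro sum_mono mult_left_mono amgm b0)
  also have "\<dots> = (s * (\<Sum>j\<le>m. b j / real (Suc j)) + 1 / s * (\<Sum>j\<le>m. b j)) / 2"
    by (simp add: sum_distrib_left sum.distrib[symmetric] sum_divide_distrib algebra_simps add_divide_distrib
        del: of_nat_Suc)
  also have "\<dots> \<le> (s * (1 / (s * s)) + 1 / s * 1) / 2"
    unfolding b1 using s b2 by (intro divide_right_mono add_mono mult_left_mono) auto
  also have "\<dots> = 1 / s"
    using s(1) by simp
  finally show ?thesis
    unfolding s_def .
qed

text \<open>Exchanging successes and failures replaces \<open>q\<close> by \<open>1 - q\<close> and
  \<open>k\<close> by \<open>m - k\<close>, so one may assume that the parameter is at most one
  half.\<close>

lemma binomial_prob_le:
  fixes q :: real
  assumes q: "0 < q" "q < 1" and k: "k \<le> m"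
  shows "real (m choose k) * q ^ k * (1 - q) ^ (m - k) \<le> 1 / sqrt (2 * min q (1 - q) * real (Suc m))"
proof (cases "q \<le> 1 / 2")
  case True
  then show ?thesis
    using binomial_prob_le_half[OF q(1) True k] by (simp add: min_def)
next
  case False
  have "real (m choose (m - k)) * (1 - q) ^ (m - k) * (1 - (1 - q)) ^ (m - (m - k))
      \<le> 1 / sqrt (2 * (1 - q) * real (Suc m))"
    using False q by (intro binomial_prob_le_half) auto
  then show ?thesis
    using False k binomial_symmetric[OF k] by (simp add: min_def mult_ac)
qed

text \<open>Sets of equal size are equally likely, so a member \<open>I\<close> has probability at
  most the binomial bound divided by \<open>?m choose card I\<close>. Summed over the antichain,
  these reciprocals are at most 1 by LYM.\<close>

lemma antichain_avg_le:
  assumes q: "0 < q" "q < 1" and M: "finite M" and A: "antichain A" "A \<subseteq> Pow M"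
  shows "subset_avg q M (\<lambda>I. of_bool (I \<in> A)) \<le> 1 / sqrt (2 * min q (1 - q) * real (Suc (card M)))"
proof -
  let ?m = "card M" and ?B = "1 / sqrt (2 * min q (1 - q) * real (Suc (card M)))"
  have card: "card I \<le> ?m" "card (M - I) = ?m - card I" if "I \<in> A" for I
    using that A M by (auto simp: card_mono card_Diff_subset finite_subset)
  have "subset_avg q M (\<lambda>I. of_bool (I \<in> A)) = (\<Sum>I\<in>A. q ^ card I * (1 - q) ^ card (M - I))"
    unfolding subset_avg_def using A M by (intro sum.mono_neutral_cong_right) auto
  also have "\<dots> \<le> (\<Sum>I\<in>A. ?B * (1 / real (?m choose card I)))"
  proof (rule sum_mono)
    fix I assume I: "I \<in> A"
    have pos: "real (?m choose card I) > 0"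
      using card[OF I] by (simp add: zero_less_binomial_iff)
    have "q ^ card I * (1 - q) ^ card (M - I) * real (?m choose card I) \<le> ?B"
      using binomial_prob_le[OF q card(1)[OF I]] unfolding card(2)[OF I] by (simp only: mult_ac)
    then have "q ^ card I * (1 - q) ^ card (M - I) \<le> ?B / real (?m choose card I)"
      using pos by (simp only: pos_le_divide_eq)
    then show "q ^ card I * (1 - q) ^ card (M - I) \<le> ?B * (1 / real (?m choose card I))"
      by simp
  qed
  also have "\<dots> = ?B * (\<Sum>I\<in>A. 1 / real (?m choose card I))"
    by (rule sum_distrib_left[symmetric])
  also have "\<dots> \<le> ?B * 1"
    using q LYM[OF M A] by (intro mult_left_mono) auto
  finally show ?thesis by simp
qed

section \<open>From the random vector to the values of the polynomial on sets\<close>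

text \<open>The vector is supported on indicator functions of subsets of \<open>{1..n}\<close>, with
  product weights; this translates probabilities into \<open>subset_avg\<close>.\<close>

lemma prob_ber_vector:
  assumes p: "0 \<le> p" "p \<le> 1"
  shows "measure_pmf.prob (ber_vector n p) {\<xi>. P \<xi>} =
    subset_avg p {1..n} (\<lambda>S. of_bool (P (\<lambda>i. of_bool (i \<in> S))))"
proof -
  let ?h = "\<lambda>S i. of_bool (i \<in> S) :: real"
  have ber: "pmf (ber p) 1 = p" "pmf (ber p) 0 = 1 - p"
    using p pmf_map_inj'[of "of_bool :: bool \<Rightarrow> real" "bernoulli_pmf p" True]
      pmf_map_inj'[of "of_bool :: bool \<Rightarrow> real" "bernoulli_pmf p" False]
    by (auto simp: ber_def inj_def)
  have pmf: "pmf (ber_vector n p) (?h S) = p ^ card S * (1 - p) ^ card ({1..n} - S)"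
    if "S \<subseteq> {1..n}" for S
  proof -
    have fin: "finite S"
      using that finite_subset by blast
    \<comment> \<open>Outside \<open>{1..n}\<close> the indicator of \<open>S\<close> vanishes, in
      agreement with the default value 0 of \<open>Pi_pmf\<close>.\<close>
    have "pmf (ber_vector n p) (?h S) = (\<Prod>i\<in>{1..n}. pmf (ber p) (?h S i))"
      unfolding ber_vector_def using that by (intro pmf_Pi') auto
    also have "\<dots> = (\<Prod>i\<in>S. pmf (ber p) (?h S i)) * (\<Prod>i\<in>{1..n} - S. pmf (ber p) (?h S i))"
      using that by (subst prod.subset_diff[of S]) (auto simp: mult.commute)
    also have "\<dots> = p ^ card S * (1 - p) ^ card ({1..n} - S)"
      by (simp add: ber)
    finally show ?thesis .
  qed
  have inj: "inj_on ?h A" for A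
    by (rule inj_onI) (auto simp: fun_eq_iff of_bool_eq_iff)
  have supp: "set_pmf (ber_vector n p) \<subseteq> ?h ` Pow {1..n}"
  proof
    fix \<xi> assume "\<xi> \<in> set_pmf (ber_vector n p)"
    then have \<xi>: "\<xi> \<in> PiE_dflt {1..n} 0 (\<lambda>_. set_pmf (ber p))"
      using set_Pi_pmf_subset'[of "{1..n}" 0 "\<lambda>_. ber p"] by (auto simp: ber_vector_def)
    have "\<xi> i = ?h {i \<in> {1..n}. \<xi> i = 1} i" for i
      using \<xi> by (cases "i \<in> {1..n}") (force simp: PiE_dflt_def ber_def)+
    then show "\<xi> \<in> ?h ` Pow {1..n}"
      by (intro image_eqI[of _ _ "{i \<in> {1..n}. \<xi> i = 1}"]) auto
  qed
  have "measure_pmf.prob (ber_vector n p) {\<xi>. P \<xi>} =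
      measure_pmf.prob (ber_vector n p) (?h ` {S \<in> Pow {1..n}. P (?h S)})"
    using supp by (intro measure_prob_cong_0) (auto simp: set_pmf_iff)
  also have "\<dots> = (\<Sum>S\<in>{S \<in> Pow {1..n}. P (?h S)}. pmf (ber_vector n p) (?h S))"
    by (subst measure_measure_pmf_finite) (auto simp: sum.reindex[OF inj])
  also have "\<dots> = subset_avg p {1..n} (\<lambda>S. of_bool (P (?h S)))"
    unfolding subset_avg_def by (intro sum.mono_neutral_cong_left) (auto simp: pmf)
  finally show ?thesis .
qed

text \<open>At the indicator of \<open>S\<close> the monomial of \<open>T\<close> is 1 if
  \<open>T \<subseteq> S\<close> and 0 otherwise.\<close>

lemma ml_eval_of_bool:
  assumes "S \<subseteq> {1..n}"
  shows "ml_eval n a (\<lambda>i. of_bool (i \<in> S)) = (\<Sum>T\<in>Pow S. a T)"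
proof -
  have "(\<Prod>i\<in>T. of_bool (i \<in> S)) = (of_bool (T \<subseteq> S) :: real)" if "T \<subseteq> {1..n}" for T
  proof (cases "T \<subseteq> S")
    case False
    then show ?thesis
      using finite_subset[OF that] by (auto simp: prod_zero_iff)
  qed (auto intro!: prod.neutral)
  then show ?thesis
    unfolding ml_eval_def using assms by (intro sum.mono_neutral_cong_right) auto
qed

text \<open>After the first stage, overwriting more edges raises the value by at least 1, so values
  in \<open>J\<close> come from an antichain. The condition on \<open>J\<close> covers half-open
  intervals of length 1 of both orientations.\<close>

lemma subset_avg_short_range_le:
  assumes p: "0 < p" "p < 1"
    and a: "\<And>S. S \<subseteq> {1..n} \<Longrightarrow> a S \<ge> 0"
    and M: "M \<subseteq> ml_hyperedges n a" "disjoint M" "\<And>e. e \<in> M \<Longrightarrow> card e = k" "k \<noteq> 0"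
    and J: "\<And>u v. u \<in> J \<Longrightarrow> v \<in> J \<Longrightarrow> v - u < (1::real)"
  shows "subset_avg p {1..n} (\<lambda>S. of_bool ((\<Sum>T\<in>Pow S. a T) \<in> J))
    \<le> 1 / sqrt (2 * min (p ^ k) (1 - p ^ k) * real (Suc (card M)))"
proof -
  let ?F = "\<lambda>S. \<Sum>T\<in>Pow S. a T"
  let ?V = "{1..n} - \<Union>M"
  have e: "e \<subseteq> {1..n}" "a e \<ge> 1" if "e \<in> M" for e
    using that M(1) a[of e] by (auto simp: ml_hyperedges_def subset_iff)
  have finM: "finite M"
    using finite_subset[of M "Pow {1..n}"] e(1) by blast
  have q: "0 < p ^ k" "p ^ k < 1"
    using p M(4) by (auto simp: power_less_one_iff)
  have "subset_avg p (?V \<union> \<Union>M) (\<lambda>S. of_bool (?F S \<in> J))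
    \<le> 1 / sqrt (2 * min (p ^ k) (1 - p ^ k) * real (Suc (card M)))"
  proof (rule subset_avg_two_stage_le[OF p finM _ M(4) M(2)])
    fix S z
    assume S: "S \<subseteq> ?V" and z: "\<And>e. e \<in> M \<Longrightarrow> z e \<subset> e"
    define U where "U I = S \<union> (\<Union>e\<in>M. if e \<in> I then e else z e)" for I
    have U: "U I \<subseteq> {1..n}" for I
      using S z e(1) unfolding U_def by (fastforce split: if_splits)
    have jump: "?F (U I) + 1 \<le> ?F (U I')" if I: "I \<subset> I'" "I' \<subseteq> M" for I I'
    proof -
      obtain e where e': "e \<in> I'" "e \<notin> I" "e \<in> M"
        using I by auto
      obtain v where v: "v \<in> e" "v \<notin> z e"
        using z[OF e'(3)] by auto
      have sub: "U I \<subseteq> U I'"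
        using I z by (fastforce simp: U_def split: if_splits)
      have in_U: "e \<subseteq> U I'"
        using e' by (auto simp: U_def)
      \<comment> \<open>The point \<open>v\<close> is missing from the first-stage state of
        \<open>e\<close>, and neither \<open>S\<close> nor another edge can supply it. Thus
        \<open>e\<close> is contained in \<open>U I'\<close> but not in \<open>U I\<close>, and its
        coefficient is gained.\<close>
      have "v \<notin> f" if "f \<in> M" "f \<noteq> e" for f
        using that e' v M(2) by (auto simp: disjoint_def)
      then have "v \<notin> U I"
        using S z v e' by (fastforce simp: U_def split: if_splits)
      then have notin_U: "\<not> e \<subseteq> U I"
        using v by auto
      have fin: "finite (Pow (U I'))" "finite (Pow (U I))"
        using U finite_subset by blast+
      have "?F (U I) + 1 \<le> ?F (U I) + a e"
        using e e' by simp
      also have "\<dots> = sum a (insert e (Pow (U I)))"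
        using notin_U fin by simp
      also have "\<dots> \<le> ?F (U I')"
      proof (rule sum_mono2)
        fix T assume "T \<in> Pow (U I') - insert e (Pow (U I))"
        then show "0 \<le> a T"
          using U[of I'] by (intro a) blast
      qed (use fin sub in_U in auto)
      finally show ?thesis .
    qed
    let ?A = "{I. I \<subseteq> M \<and> ?F (U I) \<in> J}"
    have "antichain ?A"
      unfolding antichain_def
    proof (intro ballI notI)
      fix I I' assume I: "I \<in> ?A" "I' \<in> ?A" "I \<subset> I'"
      then show False
        using jump[of I I'] J[of "?F (U I)" "?F (U I')"] by auto
    qed
    then have "subset_avg (p ^ k) M (\<lambda>I. of_bool (I \<in> ?A))
        \<le> 1 / sqrt (2 * min (p ^ k) (1 - p ^ k) * real (Suc (card M)))"
      using q finM by (intro antichain_avg_le) auto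
    also have "subset_avg (p ^ k) M (\<lambda>I. of_bool (I \<in> ?A)) =
        subset_avg (p ^ k) M (\<lambda>I. of_bool (?F (U I) \<in> J))"
      by (rule subset_avg_cong) auto
    finally show "subset_avg (p ^ k) M (\<lambda>I. of_bool (?F (S \<union> (\<Union>e\<in>M. if e \<in> I then e else z e)) \<in> J))
        \<le> 1 / sqrt (2 * min (p ^ k) (1 - p ^ k) * real (Suc (card M)))"
      unfolding U_def .
  qed (use e M(3) in \<open>auto intro: finite_subset\<close>)
  also have "?V \<union> \<Union>M = {1..n}"
    using e by auto
  finally show ?thesis .
qed

section \<open>Large matchings with edges of one size\<close>

lemma card_le_ml_degree:
  assumes "S \<subseteq> {1..n}" "a S \<noteq> 0"
  shows "card S \<le> ml_degree n a"
  unfolding ml_degree_def using assms by (intro Max_ge) auto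

lemma ml_matching_number_witness:
  obtains M where "M \<subseteq> ml_hyperedges n a" "disjoint M" "card M = ml_matching_number n a"
proof -
  let ?X = "{card M | M. M \<subseteq> ml_hyperedges n a \<and> disjoint M}"
  have "?X \<subseteq> card ` Pow (Pow {1..n})"
    by (auto simp: ml_hyperedges_def)
  then have "finite ?X"
    by (rule finite_subset) auto
  moreover have "?X \<noteq> {}"
    by (auto intro!: exI[of _ "{}"] simp: disjoint_def)
  ultimately have "Max ?X \<in> ?X"
    by (rule Max_in)
  then show ?thesis
    using that unfolding ml_matching_number_def by auto
qed

text \<open>Pigeonhole over the edge sizes \<open>1..d\<close> in a largest matching. A common size
  \<open>k\<close> gives every edge the same probability \<open>p ^ k\<close> of being all
  ones.\<close>

lemma ml_matching_uniform:
  assumes "ml_degree n a = d"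
  obtains M k where "M \<subseteq> ml_hyperedges n a" "disjoint M" "\<And>e. e \<in> M \<Longrightarrow> card e = k"
    "1 \<le> k" "k \<le> max 1 d" "ml_matching_number n a \<le> d * card M"
proof -
  obtain M where M: "M \<subseteq> ml_hyperedges n a" "disjoint M" "card M = ml_matching_number n a"
    by (rule ml_matching_number_witness)
  have finM: "finite M"
    using M(1) by (rule finite_subset) (auto simp: ml_hyperedges_def)
  have card: "card e \<in> {1..d}" if "e \<in> M" for e
  proof -
    have e: "e \<subseteq> {1..n}" "e \<noteq> {}" "a e \<noteq> 0"
      using that M(1) by (auto simp: ml_hyperedges_def)
    then have "card e > 0"
      using finite_subset by (auto simp: card_gt_0_iff)
    then show ?thesis
      using card_le_ml_degree[of e n a] e assms by auto
  qed
  let ?L = "\<lambda>k. {e \<in> M. card e = k}"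
  have eq: "card M = (\<Sum>k\<in>{1..d}. card (?L k))"
  proof -
    have "M = (\<Union>k\<in>{1..d}. ?L k)"
      using card by blast
    also have "card \<dots> = (\<Sum>k\<in>{1..d}. card (?L k))"
      using finM by (intro card_UN_disjoint) auto
    finally show ?thesis .
  qed
  show ?thesis
  proof (cases "d = 0")
    case True
    then have "M = {}"
      using card by auto
    then show ?thesis
      \<comment> \<open>For \<open>d = 0\<close> the matching is empty and the size 1 is a dummy;
        hence the bound \<open>max 1 d\<close>.\<close>
      using that[of M 1] M by simp
  next
    case False
    have "\<exists>k\<in>{1..d}. card M \<le> d * card (?L k)"
    proof (rule ccontr)
      \<comment> \<open>Summing the negated inequalities over the \<open>d\<close> sizes would give
        \<open>d * card M < d * card M\<close>.\<close>
      assume "\<not> ?thesis"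
      then have "(\<Sum>k\<in>{1..d}. d * card (?L k)) < (\<Sum>k\<in>{1..d}. card M)"
        using False by (intro sum_strict_mono) (auto simp: not_le)
      then show False
        unfolding sum_distrib_left[symmetric] eq[symmetric] by simp
    qed
    then obtain k where k: "k \<in> {1..d}" "card M \<le> d * card (?L k)" ..
    show ?thesis
    proof (rule that[of "?L k" k])
      show "?L k \<subseteq> ml_hyperedges n a" "disjoint (?L k)"
        using M by (auto simp: disjoint_def)
    qed (use k M(3) in auto)
  qed
qed

section \<open>The anticoncentration bound and its constant\<close>

theorem theorem1p1:
  fixes d :: nat and p :: real
  assumes "0 < p" and "p < 1"
  shows "\<exists>C::real. \<forall>(n::nat) (a :: nat set \<Rightarrow> real).
    ml_degree n a = d \<longrightarrow> (\<forall>S\<subseteq>{1..n}. a S \<ge> 0) \<longrightarrow> ml_matching_number n a \<ge> 1 \<longrightarrow>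
    (\<forall>x::real. measure_pmf.prob (ber_vector n p) {\<xi>. \<bar>ml_eval n a \<xi> - x\<bar> < 1}
       \<le> C / sqrt (real (ml_matching_number n a)))"
proof -
  \<comment> \<open>A lower bound for \<open>min (p ^ k) (1 - p ^ k)\<close> that is uniform in
    \<open>1 \<le> k \<le> d\<close>.\<close>
  define c where "c = min (p ^ d) (1 - p)"
  have c: "c > 0"
    using assms by (simp add: c_def)
  \<comment> \<open>The factor \<open>d\<close> under the root is the pigeonhole loss,
    \<open>2 * c\<close> comes from the binomial bound, and the outer 2 counts the half-open
    intervals.\<close>
  show ?thesis
  proof (rule exI[of _ "2 * sqrt (real d / (2 * c))"], intro allI impI)
    fix n a x
    assume deg: "ml_degree n a = d" and a: "\<forall>S\<subseteq>{1..n}. a S \<ge> 0" and r: "ml_matching_number n a \<ge> 1"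
    obtain M k where M: "M \<subseteq> ml_hyperedges n a" "disjoint M" "\<And>e. e \<in> M \<Longrightarrow> card e = k"
      and k: "1 \<le> k" "k \<le> max 1 d" and rM: "ml_matching_number n a \<le> d * card M"
      using ml_matching_uniform[OF deg] by blast
    have d: "d > 0"
      using r rM by (cases d) auto
    let ?r = "ml_matching_number n a" and ?F = "\<lambda>S. \<Sum>T\<in>Pow S. a T"
    let ?avg = "\<lambda>J. subset_avg p {1..n} (\<lambda>S. of_bool (?F S \<in> J))"
    have short: "?avg J \<le> sqrt (real d / (2 * c)) / sqrt (real ?r)"
      if J: "\<And>u v. u \<in> J \<Longrightarrow> v \<in> J \<Longrightarrow> v - u < 1" for J
    proof -
      have "p ^ d \<le> p ^ k" "p ^ k \<le> p ^ 1"
        using assms k d by (intro power_decreasing; simp)+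
      then have ck: "c \<le> min (p ^ k) (1 - p ^ k)"
        by (auto simp: c_def)
      have "real ?r \<le> real d * real (Suc (card M))"
        unfolding of_nat_mult[symmetric] of_nat_le_iff using rM by simp
      then have "2 * c / real d * real ?r \<le> 2 * c / real d * (real d * real (Suc (card M)))"
        using c by (intro mult_left_mono) auto
      also have "\<dots> = 2 * c * real (Suc (card M))"
        using d by simp
      also have "\<dots> \<le> 2 * min (p ^ k) (1 - p ^ k) * real (Suc (card M))"
        using ck by (intro mult_right_mono) auto
      finally have le: "2 * c / real d * real ?r \<le> 2 * min (p ^ k) (1 - p ^ k) * real (Suc (card M))" .
      have pos: "2 * c / real d * real ?r > 0"
        using c d r by simp
      have "?avg J \<le> 1 / sqrt (2 * min (p ^ k) (1 - p ^ k) * real (Suc (card M)))"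
        using a k by (intro subset_avg_short_range_le[OF assms _ M(1,2) M(3) _ J]) auto
      also have "\<dots> \<le> 1 / sqrt (2 * c / real d * real ?r)"
        by (intro frac_le real_sqrt_le_mono le real_sqrt_gt_zero pos) simp_all
      also have "\<dots> = sqrt (real d / (2 * c)) / sqrt (real ?r)"
        by (simp add: real_sqrt_mult real_sqrt_divide)
      finally show ?thesis .
    qed
    have "measure_pmf.prob (ber_vector n p) {\<xi>. \<bar>ml_eval n a \<xi> - x\<bar> < 1} =
        subset_avg p {1..n} (\<lambda>S. of_bool (\<bar>?F S - x\<bar> < 1))"
      unfolding prob_ber_vector[OF less_imp_le[OF assms(1)] less_imp_le[OF assms(2)]]
      by (rule subset_avg_cong) (simp add: ml_eval_of_bool)
    \<comment> \<open>Splitting at \<open>x\<close> gives two intervals in which differences stay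
      strictly below 1. Both contain \<open>x\<close>, so the two indicators only bound the original
      one from above.\<close>
    also have "\<dots> \<le> subset_avg p {1..n} (\<lambda>S. of_bool (?F S \<in> {x - 1<..x}) + of_bool (?F S \<in> {x..<x + 1}))"
      using assms by (intro subset_avg_mono) auto
    also have "\<dots> = ?avg {x - 1<..x} + ?avg {x..<x + 1}"
      by (rule subset_avg_add)
    also have "\<dots> \<le> sqrt (real d / (2 * c)) / sqrt (real ?r) + sqrt (real d / (2 * c)) / sqrt (real ?r)"
      by (intro add_mono short) auto
    finally show "measure_pmf.prob (ber_vector n p) {\<xi>. \<bar>ml_eval n a \<xi> - x\<bar> < 1}
        \<le> 2 * sqrt (real d / (2 * c)) / sqrt (real ?r)"
      by simp
  qed
qed

end
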